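(* Let $G=(V,E)$ be a directed graph in which every node has at least one out-neighbor, let $\alpha\in(0,1)$, let $v\in V$ be a target node and let $\epsilon>0$. Run the priority queue algorithm (described in the context) for target $v$ with teleport probability $\alpha$, performing pop-and-propagate steps until all priorities are less than $\alpha\epsilon$. Then the resulting score vector $s$ satisfies $|s(u)-\pi(u,v)|<\epsilon$ for all $u\in V$.
   Context: For $u\in V$ let $\mathrm{out}(u)=\{w:(u,w)\in E\}$ and $\mathrm{in}(u)=\{w:(w,u)\in E\}$. (If the original graph has nodes with no out-neighbors, an artificial sink node with a self-loop is added together with an edge from each such node to the sink, so every node has out-degree at least 1.) Personalized PageRank $\pi(u,v)$ is the expected fraction of time spent at $v$ by the following random walk: start at $u$; at each step, with probability $\alpha$ halt, and with probability $1-\alpha$ move to a uniformly random out-neighbor of the current node. Equivalently, $\pi(\cdot,v)$ is the unique solution of $\pi(u,v)=\frac{1-\alpha}{|\mathrm{out}(u)|}\sum_{w\in \mathrm{out}(u)}\pi(w,v)+\alpha\,[u=v]$. The priority queue algorithm maintains for each node $u$ a score $s(u)$ and a priority $p(u)$, both initially $0$ except $s(v)=p(v)=\alpha$, with the nodes kept in a max-priority queue keyed by $p$. A step consists of: take a node $w$ of maximum priority, let $\Delta=p(w)$, set $p(w)=0$, and for each $u\in\mathrm{in}(w)$ increase both $s(u)$ and $p(u)$ by $(1-\alpha)\Delta/|\mathrm{out}(u)|$. The algorithm repeats steps while the maximum priority exceeds $\alpha\epsilon$ and outputs $s$. *)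

theory Defs
  imports "HOL-Probability.Probability"
begin

definition out_nbrs :: "('a \<times> 'a) set \<Rightarrow> 'a \<Rightarrow> 'a set" where
  "out_nbrs E u = {w. (u, w) \<in> E}"

definition in_nbrs :: "('a \<times> 'a) set \<Rightarrow> 'a \<Rightarrow> 'a set" where
  "in_nbrs E u = {w. (w, u) \<in> E}"

text \<open>
  The trajectory of the random walk, from its start node to the node at which it halts. A walk
  occupies its current node for one unit of time before each halting decision, so a trajectory
  lists one node per unit of time.
\<close>

partial_function (spmf) ppr_walk :: "real \<Rightarrow> ('a \<times> 'a) set \<Rightarrow> 'a \<Rightarrow> 'a list spmf" where
  "ppr_walk \<alpha> E u =
     bind_pmf (bernoulli_pmf \<alpha>) (\<lambda>halt.
       if halt then return_spmf [u]
       else bind_pmf (pmf_of_set (out_nbrs E u)) (\<lambda>w. map_spmf ((#) u) (ppr_walk \<alpha> E w)))"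

text \<open>
  The expected fraction of time spent at \<open>v\<close> is the expected time spent at \<open>v\<close> relative to the
  expected duration of the walk. (The expectation of the quotient of the two would not satisfy the
  PageRank equation \<open>ppr_equation\<close> below.)
\<close>

definition ppr :: "real \<Rightarrow> ('a \<times> 'a) set \<Rightarrow> 'a \<Rightarrow> 'a \<Rightarrow> real" where
  "ppr \<alpha> E u v =
     (\<integral>xs. real (count_list xs v) \<partial>measure_spmf (ppr_walk \<alpha> E u)) /
     (\<integral>xs. real (length xs) \<partial>measure_spmf (ppr_walk \<alpha> E u))"

text \<open>
  A state of the priority queue algorithm is the pair of the score and the priority function.
  In \<open>pq_propagate\<close> the priority of the popped node is reset before it is increased, which matters
  if that node has a self-loop.
\<close>

definition pq_init :: "real \<Rightarrow> 'a \<Rightarrow> ('a \<Rightarrow> real) \<times> ('a \<Rightarrow> real)" where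
  "pq_init \<alpha> v = ((\<lambda>_. 0)(v := \<alpha>), (\<lambda>_. 0)(v := \<alpha>))"

definition pq_propagate ::
    "real \<Rightarrow> ('a \<times> 'a) set \<Rightarrow> 'a \<Rightarrow> ('a \<Rightarrow> real) \<times> ('a \<Rightarrow> real) \<Rightarrow> ('a \<Rightarrow> real) \<times> ('a \<Rightarrow> real)" where
  "pq_propagate \<alpha> E w = (\<lambda>(s, p).
     let inc = (\<lambda>u. if u \<in> in_nbrs E w then (1 - \<alpha>) * p w / real (card (out_nbrs E u)) else 0)
     in (\<lambda>u. s u + inc u, \<lambda>u. (p(w := 0)) u + inc u))"

text \<open>
  The states that some run of the algorithm passes through: a step is performed only while not all
  priorities are below the threshold, and ties for the maximum priority are broken arbitrarily.
\<close>

inductive pq_reaches ::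
    "'a set \<Rightarrow> ('a \<times> 'a) set \<Rightarrow> real \<Rightarrow> real \<Rightarrow> 'a \<Rightarrow> ('a \<Rightarrow> real) \<times> ('a \<Rightarrow> real) \<Rightarrow> bool"
  for V E \<alpha> \<epsilon> v where
  init: "pq_reaches V E \<alpha> \<epsilon> v (pq_init \<alpha> v)"
| step: "pq_reaches V E \<alpha> \<epsilon> v (s, p) \<Longrightarrow> \<not> (\<forall>u\<in>V. p u < \<alpha> * \<epsilon>) \<Longrightarrow>
    w \<in> V \<Longrightarrow> \<forall>u\<in>V. p u \<le> p w \<Longrightarrow>
    pq_reaches V E \<alpha> \<epsilon> v (pq_propagate \<alpha> E w (s, p))"

lemma nn_integral_ppr_walk:
  assumes "0 < \<alpha>" "\<alpha> < 1" "finite (out_nbrs E u)" "out_nbrs E u \<noteq> {}"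
  shows "(\<integral>\<^sup>+xs. f xs \<partial>measure_spmf (ppr_walk \<alpha> E u)) =
    ennreal \<alpha> * f [u] + ennreal (1 - \<alpha>) *
      ((\<Sum>w\<in>out_nbrs E u. \<integral>\<^sup>+xs. f (u # xs) \<partial>measure_spmf (ppr_walk \<alpha> E w)) / card (out_nbrs E u))"
proof -
  have *: "(\<integral>\<^sup>+xs. f xs \<partial>measure_spmf (bind_pmf p g)) =
      (\<integral>\<^sup>+x. \<integral>\<^sup>+xs. f xs \<partial>measure_spmf (g x) \<partial>measure_pmf p)" for p :: "'x pmf" and g f
    by (subst measure_spmf_bind_pmf, subst nn_integral_bind[where B = "count_space UNIV"])
       (auto simp: o_def space_subprob_algebra)
  show ?thesis
    using assms
    by (subst ppr_walk.simps)
       (simp add: * nn_integral_pmf_of_set o_def mult.commute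
          nn_integral_return measure_spmf_return_spmf)
qed

lemma ppr_contraction:
  fixes d :: "'a \<Rightarrow> real"
  assumes "E \<subseteq> V \<times> V" "\<forall>u\<in>V. out_nbrs E u \<noteq> {}" "\<forall>u\<in>V. finite (out_nbrs E u)"
    and alpha: "0 < \<alpha>" "\<alpha> < 1"
    and bounded: "\<And>u. u \<in> V \<Longrightarrow> \<bar>d u\<bar> \<le> B"
    and eq: "\<And>u. u \<in> V \<Longrightarrow> d u = (1 - \<alpha>) / card (out_nbrs E u) * (\<Sum>w\<in>out_nbrs E u. d w)"
    and "u \<in> V"
  shows "d u = 0"
proof -
  have "\<bar>d u\<bar> \<le> (1 - \<alpha>) ^ n * B" if "u \<in> V" for n u
    using that
  proof (induction n arbitrary: u)
    case 0
    then show ?case using bounded by simp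
  next
    case (Suc n)
    let ?O = "out_nbrs E u"
    have sub: "?O \<subseteq> V" using assms(1) by (auto simp: out_nbrs_def)
    have card: "card ?O > 0" using assms(2,3) Suc.prems by (simp add: card_gt_0_iff)
    have "\<bar>\<Sum>w\<in>?O. d w\<bar> \<le> (\<Sum>w\<in>?O. \<bar>d w\<bar>)" by (rule sum_abs)
    also have "\<dots> \<le> (\<Sum>w\<in>?O. (1 - \<alpha>) ^ n * B)" using Suc.IH sub by (intro sum_mono) auto
    also have "\<dots> = card ?O * ((1 - \<alpha>) ^ n * B)" by simp
    finally have le: "\<bar>\<Sum>w\<in>?O. d w\<bar> \<le> card ?O * ((1 - \<alpha>) ^ n * B)" .
    have "\<bar>d u\<bar> = (1 - \<alpha>) / card ?O * \<bar>\<Sum>w\<in>?O. d w\<bar>"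
      using alpha by (subst eq[OF Suc.prems]) (simp add: abs_mult)
    also have "\<dots> \<le> (1 - \<alpha>) / card ?O * (card ?O * ((1 - \<alpha>) ^ n * B))"
      using alpha by (intro mult_left_mono le) auto
    also have "\<dots> = (1 - \<alpha>) ^ Suc n * B" using card by simp
    finally show ?case .
  qed
  moreover have "(\<lambda>n. (1 - \<alpha>) ^ n * B) \<longlonglongrightarrow> 0 * B"
    using alpha by (intro tendsto_intros LIMSEQ_power_zero) auto
  ultimately have "\<bar>d u\<bar> \<le> 0 * B"
    using \<open>u \<in> V\<close> by (intro LIMSEQ_le_const) auto
  then show ?thesis by simp
qed

lemma ppr_walk_tail:
  assumes "E \<subseteq> V \<times> V" "\<forall>u\<in>V. out_nbrs E u \<noteq> {}" "\<forall>u\<in>V. finite (out_nbrs E u)"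
    and alpha: "0 < \<alpha>" "\<alpha> < 1" and "u \<in> V"
  shows "emeasure (measure_spmf (ppr_walk \<alpha> E u)) {xs. n < length xs} \<le> ennreal ((1 - \<alpha>) ^ n)"
  using \<open>u \<in> V\<close>
proof (induction n arbitrary: u)
  case 0
  show ?case using measure_spmf.subprob_emeasure_le_1 by simp
next
  case (Suc n)
  let ?O = "out_nbrs E u"
  let ?M = "\<lambda>w. measure_spmf (ppr_walk \<alpha> E w)"
  have sub: "?O \<subseteq> V" using assms(1) by (auto simp: out_nbrs_def)
  have fin: "finite ?O" "?O \<noteq> {}" using assms(2,3) Suc.prems by auto
  then have card: "card ?O > 0" by (simp add: card_gt_0_iff)
  have ind: "(\<integral>\<^sup>+xs. indicator {xs. Suc n < length xs} (u # xs) \<partial>?M w) =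
      emeasure (?M w) {xs. n < length xs}" for w
  proof -
    have "(\<integral>\<^sup>+xs. indicator {xs. Suc n < length xs} (u # xs) \<partial>?M w) =
        (\<integral>\<^sup>+xs. indicator {xs. n < length xs} xs \<partial>?M w)"
      by (intro nn_integral_cong) (simp add: indicator_def)
    then show ?thesis by simp
  qed
  have "emeasure (?M u) {xs. Suc n < length xs} =
      (\<integral>\<^sup>+xs. indicator {xs. Suc n < length xs} xs \<partial>?M u)" by simp
  also have "\<dots> = ennreal (1 - \<alpha>) * ((\<Sum>w\<in>?O. emeasure (?M w) {xs. n < length xs}) / card ?O)"
    using alpha fin by (subst nn_integral_ppr_walk) (simp_all add: ind)
  also have "\<dots> \<le> ennreal (1 - \<alpha>) * ((\<Sum>w\<in>?O. ennreal ((1 - \<alpha>) ^ n)) / card ?O)"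
    using Suc.IH sub by (intro mult_left_mono divide_right_mono_ennreal sum_mono) auto
  also have "\<dots> = ennreal ((1 - \<alpha>) ^ Suc n)"
    using card alpha
    by (simp add: ennreal_of_nat_eq_real_of_nat divide_ennreal ennreal_mult[symmetric])
  finally show ?case .
qed

lemma nn_integral_length_ppr_walk:
  assumes "E \<subseteq> V \<times> V" "\<forall>u\<in>V. out_nbrs E u \<noteq> {}" "\<forall>u\<in>V. finite (out_nbrs E u)"
    and alpha: "0 < \<alpha>" "\<alpha> < 1" and "u \<in> V"
  shows "(\<integral>\<^sup>+xs. of_nat (length xs) \<partial>measure_spmf (ppr_walk \<alpha> E u)) \<le> ennreal (1 / \<alpha>)"
proof -
  have "(\<integral>\<^sup>+xs. of_nat (length xs) \<partial>measure_spmf (ppr_walk \<alpha> E u)) =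
      (\<Sum>n. emeasure (measure_spmf (ppr_walk \<alpha> E u)) {xs. n < length xs})"
    by (subst nn_integral_nat_function) (auto simp: space_measure_spmf)
  also have "\<dots> \<le> (\<Sum>n. ennreal ((1 - \<alpha>) ^ n))"
    using assms by (intro suminf_le ppr_walk_tail) auto
  also have "\<dots> = ennreal (\<Sum>n. (1 - \<alpha>) ^ n)"
    using alpha by (intro suminf_ennreal2 summable_geometric) auto
  also have "(\<Sum>n. (1 - \<alpha>) ^ n) = 1 / \<alpha>"
    using alpha by (subst suminf_geometric) auto
  finally show ?thesis .
qed

lemma integral_ppr_walk:
  fixes f :: "'a list \<Rightarrow> real"
  assumes "E \<subseteq> V \<times> V" "\<forall>u\<in>V. out_nbrs E u \<noteq> {}" "\<forall>u\<in>V. finite (out_nbrs E u)"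
    and alpha: "0 < \<alpha>" "\<alpha> < 1" and "u \<in> V"
    and f: "\<And>xs. 0 \<le> f xs" "\<And>xs. f xs \<le> 1 + real (length xs)"
  shows "integrable (measure_spmf (ppr_walk \<alpha> E u)) f"
    and "\<bar>\<integral>xs. f xs \<partial>measure_spmf (ppr_walk \<alpha> E u)\<bar> \<le> 1 + 1 / \<alpha>"
    and "(\<integral>xs. f xs \<partial>measure_spmf (ppr_walk \<alpha> E u)) =
      \<alpha> * f [u] + (1 - \<alpha>) / card (out_nbrs E u) *
        (\<Sum>w\<in>out_nbrs E u. \<integral>xs. f (u # xs) \<partial>measure_spmf (ppr_walk \<alpha> E w))"
proof -
  let ?O = "out_nbrs E u"
  let ?M = "\<lambda>w. measure_spmf (ppr_walk \<alpha> E w)"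
  have sub: "?O \<subseteq> V" using assms(1) by (auto simp: out_nbrs_def)
  have fin: "finite ?O" "?O \<noteq> {}" using assms(2,3) \<open>u \<in> V\<close> by auto
  then have card: "card ?O > 0" by (simp add: card_gt_0_iff)
  have bnd: "(\<integral>\<^sup>+xs. ennreal (g xs) \<partial>?M w) \<le> ennreal (a + 1 / \<alpha>)"
    if "w \<in> V" "0 \<le> a" "\<And>xs. g xs \<le> a + real (length xs)" for w a and g :: "'a list \<Rightarrow> real"
  proof -
    have "(\<integral>\<^sup>+xs. ennreal (g xs) \<partial>?M w) \<le> (\<integral>\<^sup>+xs. ennreal a + of_nat (length xs) \<partial>?M w)"
      using that by (intro nn_integral_mono)
        (auto simp: ennreal_of_nat_eq_real_of_nat ennreal_plus[symmetric] simp del: ennreal_plus intro!: ennreal_leI)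
    also have "\<dots> = ennreal a * emeasure (?M w) (space (?M w)) + (\<integral>\<^sup>+xs. of_nat (length xs) \<partial>?M w)"
      by (subst nn_integral_add) auto
    also have "\<dots> \<le> ennreal a * 1 + ennreal (1 / \<alpha>)"
      using assms that by (intro add_mono mult_left_mono nn_integral_length_ppr_walk
        measure_spmf.subprob_emeasure_le_1) auto
    also have "\<dots> = ennreal (a + 1 / \<alpha>)"
      using that alpha by simp
    finally show ?thesis .
  qed
  have int: "integrable (?M w) g"
    if "w \<in> V" "0 \<le> a" "\<And>xs. 0 \<le> g xs" "\<And>xs. g xs \<le> a + real (length xs)"
    for w a and g :: "'a list \<Rightarrow> real"
    using bnd[OF that(1,2,4)] that(3)
    by (intro integrableI_bounded) (auto simp: order_le_less_trans)
  show intf: "integrable (?M u) f"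
    using int[of u 1 f] f \<open>u \<in> V\<close> by auto
  have nn: "(\<integral>\<^sup>+xs. ennreal (f xs) \<partial>?M u) = ennreal (\<integral>xs. f xs \<partial>?M u)"
    using intf f by (intro nn_integral_eq_integral) auto
  have nn': "(\<integral>\<^sup>+xs. ennreal (f (u # xs)) \<partial>?M w) = ennreal (\<integral>xs. f (u # xs) \<partial>?M w)"
    if "w \<in> ?O" for w
  proof (intro nn_integral_eq_integral)
    show "integrable (?M w) (\<lambda>xs. f (u # xs))"
    proof (rule int[of w 2])
      show "f (u # xs) \<le> 2 + real (length xs)" for xs using f(2)[of "u # xs"] by simp
    qed (use that sub f in auto)
  qed (use f in auto)
  have pos: "0 \<le> (\<integral>xs. f (u # xs) \<partial>?M w)" for w
    using f by (intro integral_nonneg_AE) auto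
  have posu: "0 \<le> (\<integral>xs. f xs \<partial>?M u)"
    using f by (intro integral_nonneg_AE) auto
  show "\<bar>\<integral>xs. f xs \<partial>?M u\<bar> \<le> 1 + 1 / \<alpha>"
    using bnd[of u 1 f] f \<open>u \<in> V\<close> alpha posu unfolding nn
    by (simp add: ennreal_le_iff del: ennreal_plus)
  have "ennreal (\<integral>xs. f xs \<partial>?M u) = ennreal \<alpha> * ennreal (f [u]) + ennreal (1 - \<alpha>) *
      ((\<Sum>w\<in>?O. ennreal (\<integral>xs. f (u # xs) \<partial>?M w)) / card ?O)"
    unfolding nn[symmetric] using alpha fin
    by (subst nn_integral_ppr_walk) (simp_all add: nn')
  also have "\<dots> = ennreal (\<alpha> * f [u] + (1 - \<alpha>) * ((\<Sum>w\<in>?O. \<integral>xs. f (u # xs) \<partial>?M w) / card ?O))"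
    using alpha f(1) pos card
    by (simp add: sum_ennreal ennreal_of_nat_eq_real_of_nat divide_ennreal sum_nonneg
         ennreal_plus[symmetric] ennreal_mult[symmetric] del: ennreal_plus)
  finally show "(\<integral>xs. f xs \<partial>?M u) = \<alpha> * f [u] + (1 - \<alpha>) / card ?O * (\<Sum>w\<in>?O. \<integral>xs. f (u # xs) \<partial>?M w)"
    using alpha f(1) pos posu
    by (subst (asm) ennreal_inj) (auto intro!: add_nonneg_nonneg mult_nonneg_nonneg divide_nonneg_nonneg sum_nonneg)
qed

lemma lossless_ppr_walk:
  assumes "E \<subseteq> V \<times> V" "\<forall>u\<in>V. out_nbrs E u \<noteq> {}" "\<forall>u\<in>V. finite (out_nbrs E u)"
    and alpha: "0 < \<alpha>" "\<alpha> < 1" and "u \<in> V"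
  shows "lossless_spmf (ppr_walk \<alpha> E u)"
proof -
  let ?m = "\<lambda>u. weight_spmf (ppr_walk \<alpha> E u)"
  have "1 - ?m u = 0"
  proof (rule ppr_contraction[where B = 1, OF assms(1-5) _ _ \<open>u \<in> V\<close>])
    fix u assume u: "u \<in> V"
    show "\<bar>1 - ?m u\<bar> \<le> 1"
      using weight_spmf_le_1[of "ppr_walk \<alpha> E u"] weight_spmf_nonneg[of "ppr_walk \<alpha> E u"] by linarith
    have "card (out_nbrs E u) > 0" using assms(2,3) u by (simp add: card_gt_0_iff)
    then show "1 - ?m u = (1 - \<alpha>) / card (out_nbrs E u) * (\<Sum>w\<in>out_nbrs E u. 1 - ?m w)"
      using integral_ppr_walk(3)[OF assms(1-5) u, of "\<lambda>_. 1"]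
      by (simp add: sum_subtractf field_simps)
  qed
  then show ?thesis by (simp add: lossless_spmf_def)
qed

lemma expected_duration_ppr_walk:
  assumes "E \<subseteq> V \<times> V" "\<forall>u\<in>V. out_nbrs E u \<noteq> {}" "\<forall>u\<in>V. finite (out_nbrs E u)"
    and alpha: "0 < \<alpha>" "\<alpha> < 1" and "u \<in> V"
  shows "(\<integral>xs. real (length xs) \<partial>measure_spmf (ppr_walk \<alpha> E u)) = 1 / \<alpha>"
proof -
  let ?L = "\<lambda>u. \<integral>xs. real (length xs) \<partial>measure_spmf (ppr_walk \<alpha> E u)"
  have "?L u - 1 / \<alpha> = 0"
  proof (rule ppr_contraction[where B = "1 + 2 / \<alpha>", OF assms(1-5) _ _ \<open>u \<in> V\<close>])
    fix u assume u: "u \<in> V"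
    have "\<bar>?L u\<bar> \<le> 1 + 1 / \<alpha>" by (rule integral_ppr_walk(2)[OF assms(1-5) u]) auto
    moreover have "1 / \<alpha> > 0" using alpha by simp
    ultimately show "\<bar>?L u - 1 / \<alpha>\<bar> \<le> 1 + 2 / \<alpha>" by linarith
    have card: "card (out_nbrs E u) > 0" using assms(2,3) u by (simp add: card_gt_0_iff)
    have "(\<integral>xs. real (length (u # xs)) \<partial>measure_spmf (ppr_walk \<alpha> E w)) = 1 + ?L w"
      if "w \<in> out_nbrs E u" for w
    proof -
      have w: "w \<in> V" using that assms(1) by (auto simp: out_nbrs_def)
      have "integrable (measure_spmf (ppr_walk \<alpha> E w)) (\<lambda>xs. real (length xs))"
        by (rule integral_ppr_walk(1)[OF assms(1-5) w]) auto
      then show ?thesis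
        using lossless_ppr_walk[OF assms(1-5) w] by (simp add: lossless_spmf_def)
    qed
    then have "?L u = \<alpha> + (1 - \<alpha>) / card (out_nbrs E u) * (\<Sum>w\<in>out_nbrs E u. 1 + ?L w)"
      using integral_ppr_walk(3)[OF assms(1-5) u, of "\<lambda>xs. real (length xs)"] by simp
    then have "?L u = 1 + (1 - \<alpha>) / card (out_nbrs E u) * (\<Sum>w\<in>out_nbrs E u. ?L w)"
      unfolding sum.distrib using card by (simp add: field_simps)
    moreover have "1 - 1 / \<alpha> = - ((1 - \<alpha>) / card (out_nbrs E u) * (card (out_nbrs E u) * (1 / \<alpha>)))"
      using card alpha by (simp add: field_simps)
    ultimately show "?L u - 1 / \<alpha> = (1 - \<alpha>) / card (out_nbrs E u) * (\<Sum>w\<in>out_nbrs E u. ?L w - 1 / \<alpha>)"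
      unfolding sum_subtractf right_diff_distrib by simp
  qed
  then show ?thesis by simp
qed

lemma ppr_equation:
  assumes "E \<subseteq> V \<times> V" "\<forall>u\<in>V. out_nbrs E u \<noteq> {}" "\<forall>u\<in>V. finite (out_nbrs E u)"
    and alpha: "0 < \<alpha>" "\<alpha> < 1" and u: "u \<in> V"
  shows "ppr \<alpha> E u v =
    (1 - \<alpha>) / card (out_nbrs E u) * (\<Sum>w\<in>out_nbrs E u. ppr \<alpha> E w v) + \<alpha> * of_bool (u = v)"
proof -
  let ?C = "\<lambda>u. \<integral>xs. real (count_list xs v) \<partial>measure_spmf (ppr_walk \<alpha> E u)"
  have ppr: "ppr \<alpha> E u v = \<alpha> * ?C u" if "u \<in> V" for u
    using expected_duration_ppr_walk[OF assms(1-5) that] by (simp add: ppr_def)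
  have card: "card (out_nbrs E u) > 0" using assms(2,3) u by (simp add: card_gt_0_iff)
  have le: "real (count_list xs v) \<le> 1 + real (length xs)" for xs
    using count_le_length[of xs v] by linarith
  have sub: "out_nbrs E u \<subseteq> V" using assms(1) by (auto simp: out_nbrs_def)
  have "(\<integral>xs. real (count_list (u # xs) v) \<partial>measure_spmf (ppr_walk \<alpha> E w)) = of_bool (u = v) + ?C w"
    if "w \<in> out_nbrs E u" for w
  proof -
    have w: "w \<in> V" using that sub by auto
    have "integrable (measure_spmf (ppr_walk \<alpha> E w)) (\<lambda>xs. real (count_list xs v))"
      by (rule integral_ppr_walk(1)[OF assms(1-5) w]) (use le in auto)
    then show ?thesis
      using lossless_ppr_walk[OF assms(1-5) w] by (simp add: lossless_spmf_def)
  qed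
  then have "?C u = \<alpha> * of_bool (u = v) +
      (1 - \<alpha>) / card (out_nbrs E u) * (\<Sum>w\<in>out_nbrs E u. of_bool (u = v) + ?C w)"
    using integral_ppr_walk(3)[OF assms(1-5) u, of "\<lambda>xs. real (count_list xs v)"] le by simp
  then have "?C u = of_bool (u = v) + (1 - \<alpha>) / card (out_nbrs E u) * (\<Sum>w\<in>out_nbrs E u. ?C w)"
    using card by (simp add: sum.distrib field_simps)
  moreover have "(\<Sum>w\<in>out_nbrs E u. ppr \<alpha> E w v) = \<alpha> * (\<Sum>w\<in>out_nbrs E u. ?C w)"
    using sub by (auto simp: sum_distrib_left ppr intro!: sum.cong)
  ultimately show ?thesis
    by (simp add: ppr u algebra_simps)
qed

lemma ppr_equation_unique:
  fixes f :: "'a \<Rightarrow> real"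
  assumes "E \<subseteq> V \<times> V" "\<forall>u\<in>V. out_nbrs E u \<noteq> {}" "\<forall>u\<in>V. finite (out_nbrs E u)"
    and alpha: "0 < \<alpha>" "\<alpha> < 1"
    and bounded: "bounded (f ` V)"
    and eq: "\<And>u. u \<in> V \<Longrightarrow>
      f u = (1 - \<alpha>) / card (out_nbrs E u) * (\<Sum>w\<in>out_nbrs E u. f w) + \<alpha> * of_bool (u = v)"
    and u: "u \<in> V"
  shows "f u = ppr \<alpha> E u v"
proof -
  obtain B where B: "\<And>u. u \<in> V \<Longrightarrow> \<bar>f u\<bar> \<le> B"
    using bounded by (auto simp: bounded_iff)
  have "f u - ppr \<alpha> E u v = 0"
  proof (rule ppr_contraction[where B = "B + \<alpha> * (1 + 1 / \<alpha>)", OF assms(1-5) _ _ u])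
    fix u assume u: "u \<in> V"
    have le: "real (count_list xs v) \<le> 1 + real (length xs)" for xs
      using count_le_length[of xs v] by linarith
    have "\<bar>\<integral>xs. real (count_list xs v) \<partial>measure_spmf (ppr_walk \<alpha> E u)\<bar> \<le> 1 + 1 / \<alpha>"
      by (rule integral_ppr_walk(2)[OF assms(1-5) u]) (use le in auto)
    then have "\<bar>ppr \<alpha> E u v\<bar> \<le> \<alpha> * (1 + 1 / \<alpha>)"
      using expected_duration_ppr_walk[OF assms(1-5) u] alpha
      by (simp add: ppr_def abs_mult)
    then show "\<bar>f u - ppr \<alpha> E u v\<bar> \<le> B + \<alpha> * (1 + 1 / \<alpha>)"
      using B[OF u] by linarith
    show "f u - ppr \<alpha> E u v =
        (1 - \<alpha>) / card (out_nbrs E u) * (\<Sum>w\<in>out_nbrs E u. f w - ppr \<alpha> E w v)"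
      using eq[OF u] ppr_equation[OF assms(1-5) u, of v] by (simp add: sum_subtractf right_diff_distrib)
  qed
  then show ?thesis by simp
qed

end

theory Submission
  imports Defs
begin

text \<open>
  Every step of the algorithm preserves
  \<open>s u = \<alpha> [u = v] + (1 - \<alpha>) / |out u| * (\<Sum>w\<in>out u. s w - p w)\<close>: popping \<open>w\<close> changes \<open>s - p\<close> only at
  \<open>w\<close>, namely by \<open>p w\<close>. Subtracting the PageRank equation, the error \<open>d = \<pi> - s\<close> satisfies
  \<open>d u = (1 - \<alpha>) * (average of d + p over out u)\<close>. When the priorities lie between \<open>0\<close> and
  \<open>\<alpha> \<epsilon>\<close>, the supremum \<open>D\<close> of \<open>|d|\<close> therefore satisfies \<open>D \<le> (1 - \<alpha>) (D + \<alpha> \<epsilon>)\<close>, that is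
  \<open>D \<le> (1 - \<alpha>) \<epsilon> < \<epsilon>\<close>. As \<open>V\<close> may be infinite, this uses that \<open>s\<close> and \<open>\<pi>\<close> are bounded.
\<close>

lemma abs_average_le:
  fixes d :: "'a \<Rightarrow> real"
  assumes "finite A" "A \<noteq> {}" "0 \<le> c" "\<And>w. w \<in> A \<Longrightarrow> \<bar>d w\<bar> \<le> B"
  shows "\<bar>c / card A * (\<Sum>w\<in>A. d w)\<bar> \<le> c * B"
proof -
  have card: "card A > 0" using assms(1,2) by (simp add: card_gt_0_iff)
  have "\<bar>\<Sum>w\<in>A. d w\<bar> \<le> (\<Sum>w\<in>A. \<bar>d w\<bar>)" by (rule sum_abs)
  also have "\<dots> \<le> card A * B" using assms(4) by (rule sum_bounded_above)
  finally have "c / card A * \<bar>\<Sum>w\<in>A. d w\<bar> \<le> c / card A * (card A * B)"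
    using assms(3) by (intro mult_left_mono) auto
  then show ?thesis using card assms(3) by (simp add: abs_mult)
qed

text \<open>A quantitative form of \<open>ppr_contraction\<close>, which is the case
  \<open>b = 0\<close>. Boundedness makes the supremum \<open>D\<close> finite, so
  \<open>(1 - \<alpha>) * D\<close> can be moved to the left-hand side.\<close>

lemma averaging_equation_bound:
  fixes d q :: "'a \<Rightarrow> real"
  assumes "E \<subseteq> V \<times> V" "\<forall>u\<in>V. out_nbrs E u \<noteq> {}" "\<forall>u\<in>V. finite (out_nbrs E u)"
    and alpha: "0 < \<alpha>" "\<alpha> < 1"
    and bounded: "bounded (d ` V)"
    and q: "\<And>u. u \<in> V \<Longrightarrow> \<bar>q u\<bar> \<le> b"
    and eq: "\<And>u. u \<in> V \<Longrightarrow>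
      d u = (1 - \<alpha>) / card (out_nbrs E u) * (\<Sum>w\<in>out_nbrs E u. d w + q w)"
    and "u \<in> V"
  shows "\<alpha> * \<bar>d u\<bar> \<le> (1 - \<alpha>) * b"
proof -
  define D where "D = (SUP u\<in>V. \<bar>d u\<bar>)"
  have bdd: "bdd_above ((\<lambda>u. \<bar>d u\<bar>) ` V)"
    using bounded by (auto simp: bounded_iff bdd_above_def)
  have D: "\<bar>d u\<bar> \<le> D" if "u \<in> V" for u
    unfolding D_def using bdd that by (rule cSUP_upper2) simp
  have "D \<le> (1 - \<alpha>) * (D + b)"
    unfolding D_def
  proof (rule cSUP_least)
    fix u assume u: "u \<in> V"
    have "\<bar>d w + q w\<bar> \<le> D + b" if "w \<in> out_nbrs E u" for w
    proof -
      have "w \<in> V" using that assms(1) by (auto simp: out_nbrs_def)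
      then show ?thesis using D[of w] q[of w] by linarith
    qed
    then show "\<bar>d u\<bar> \<le> (1 - \<alpha>) * ((SUP u\<in>V. \<bar>d u\<bar>) + b)"
      unfolding D_def[symmetric] using alpha assms(2,3) u
      by (subst eq[OF u], intro abs_average_le) auto
  qed (use \<open>u \<in> V\<close> in auto)
  then have "\<alpha> * D \<le> (1 - \<alpha>) * b" by (simp add: algebra_simps)
  moreover have "\<alpha> * \<bar>d u\<bar> \<le> \<alpha> * D" using alpha D[OF \<open>u \<in> V\<close>] by simp
  ultimately show ?thesis by linarith
qed

text \<open>The expected number of visits to \<open>v\<close> is at most
  \<open>1 + 1 / \<alpha>\<close>, and dividing by the expected duration \<open>1 / \<alpha>\<close>
  multiplies it by \<open>\<alpha>\<close>.\<close>

lemma bounded_ppr: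
  assumes "E \<subseteq> V \<times> V" "\<forall>u\<in>V. out_nbrs E u \<noteq> {}" "\<forall>u\<in>V. finite (out_nbrs E u)"
    and alpha: "0 < \<alpha>" "\<alpha> < 1"
  shows "bounded ((\<lambda>u. ppr \<alpha> E u v) ` V)"
proof -
  have "\<bar>ppr \<alpha> E u v\<bar> \<le> \<alpha> * (1 + 1 / \<alpha>)" if u: "u \<in> V" for u
  proof -
    have le: "real (count_list xs v) \<le> 1 + real (length xs)" for xs
      using count_le_length[of xs v] by linarith
    have "\<bar>\<integral>xs. real (count_list xs v) \<partial>measure_spmf (ppr_walk \<alpha> E u)\<bar> \<le> 1 + 1 / \<alpha>"
      by (rule integral_ppr_walk(2)[OF assms u]) (use le in auto)
    then show ?thesis
      using expected_duration_ppr_walk[OF assms u] alpha by (simp add: ppr_def abs_mult)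
  qed
  then show ?thesis by (auto simp: bounded_iff)
qed

text \<open>The induction runs over all nodes at once, since the increment at \<open>u\<close> is a
  nonnegative multiple of the priority of the popped node.\<close>

lemma pq_reaches_priority_nonneg:
  assumes "pq_reaches V E \<alpha> \<epsilon> v (s, p)" "0 < \<alpha>" "\<alpha> < 1"
  shows "0 \<le> p u"
  using assms(1)
proof (induction "(s, p)" arbitrary: s p u)
  case init
  then show ?case using assms(2) by (auto simp: pq_init_def split: if_splits)
next
  case (step s p w s' p')
  then show ?case using assms(3) by (auto simp: pq_propagate_def Let_def)
qed

text \<open>One step raises every score by at most \<open>(1 - \<alpha>) * p w\<close>, a bound
  uniform in the node, and a run has made only finitely many steps.\<close>

lemma pq_reaches_bounded_score:
  assumes "pq_reaches V E \<alpha> \<epsilon> v (s, p)" "0 < \<alpha>" "\<alpha> < 1"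
  shows "bounded (s ` V)"
  using assms(1)
proof (induction "(s, p)" arbitrary: s p)
  case init
  then show ?case using assms(2)
    by (auto simp: pq_init_def bounded_iff intro!: exI[of _ \<alpha>])
next
  case (step s p w s' p')
  define inc where
    "inc u = (if u \<in> in_nbrs E w then (1 - \<alpha>) * p w / real (card (out_nbrs E u)) else 0)" for u
  have s': "s' u = s u + inc u" for u
    using step(6) by (auto simp: pq_propagate_def Let_def inc_def)
  have nonneg: "0 \<le> (1 - \<alpha>) * p w"
    using pq_reaches_priority_nonneg[OF step(1) assms(2,3)] assms(3) by simp
  \<comment> \<open>For \<open>n = 0\<close> the quotient is 0 by convention.\<close>
  have "x / real n \<le> x" if "0 \<le> x" for x :: real and n :: nat
    using that by (cases n) (auto simp: field_simps)
  then have inc: "\<bar>inc u\<bar> \<le> (1 - \<alpha>) * p w" for u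
    using nonneg by (auto simp: inc_def)
  obtain B where "\<And>u. u \<in> V \<Longrightarrow> \<bar>s u\<bar> \<le> B"
    using step(2) by (auto simp: bounded_iff)
  then have "\<bar>s' u\<bar> \<le> B + (1 - \<alpha>) * p w" if "u \<in> V" for u
    using that inc[of u] s'[of u] by fastforce
  then show ?case by (auto simp: bounded_iff)
qed

lemma pq_reaches_invariant:
  assumes "pq_reaches V E \<alpha> \<epsilon> v (s, p)" "\<forall>u\<in>V. finite (out_nbrs E u)" "u \<in> V"
  shows "s u = (1 - \<alpha>) / card (out_nbrs E u) * (\<Sum>w\<in>out_nbrs E u. s w - p w) + \<alpha> * of_bool (u = v)"
  using assms(1)
proof (induction "(s, p)" arbitrary: s p)
  case init
  \<comment> \<open>Initially \<open>s = p\<close>, so the sum vanishes.\<close>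
  then show ?case by (auto simp: pq_init_def)
next
  case (step s p w s' p')
  \<comment> \<open>The increment cancels in the difference, even at \<open>w\<close> itself when
    \<open>w\<close> has a self-loop; only the reset of \<open>p w\<close> remains.\<close>
  have diff: "s' x - p' x = (s x - p x) + (if x = w then p w else 0)" for x
    using step(6) by (auto simp: pq_propagate_def Let_def)
  have "(\<Sum>x\<in>out_nbrs E u. s' x - p' x) =
      (\<Sum>x\<in>out_nbrs E u. s x - p x) + (if w \<in> out_nbrs E u then p w else 0)"
    unfolding diff sum.distrib using assms(2,3) by simp
  \<comment> \<open>Since \<open>u \<in> in_nbrs E w\<close> means
    \<open>w \<in> out_nbrs E u\<close>, the score grows exactly when the sum does.\<close>
  moreover have "s' u = s u + (if w \<in> out_nbrs E u then (1 - \<alpha>) * p w / card (out_nbrs E u) else 0)"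
    using step(6) by (auto simp: pq_propagate_def Let_def in_nbrs_def out_nbrs_def)
  ultimately show ?case using step(2) by (simp add: distrib_left)
qed

theorem theorem1:
  fixes V :: "'a set" and E :: "('a \<times> 'a) set" and \<alpha> \<epsilon> :: real and v :: 'a
    and s p :: "'a \<Rightarrow> real"
  assumes graph: "E \<subseteq> V \<times> V"
    and out_nonempty: "\<forall>u\<in>V. out_nbrs E u \<noteq> {}"
    and out_finite: "\<forall>u\<in>V. finite (out_nbrs E u)"
    and alpha: "0 < \<alpha>" "\<alpha> < 1"
    and target: "v \<in> V"
    and eps: "\<epsilon> > 0"
    and run: "pq_reaches V E \<alpha> \<epsilon> v (s, p)"
    and halted: "\<forall>u\<in>V. p u < \<alpha> * \<epsilon>"
  shows "\<forall>u\<in>V. \<bar>s u - ppr \<alpha> E u v\<bar> < \<epsilon>"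
proof
  fix u assume u: "u \<in> V"
  note G = graph out_nonempty out_finite alpha
  let ?d = "\<lambda>u. ppr \<alpha> E u v - s u"
  have "\<alpha> * \<bar>?d u\<bar> \<le> (1 - \<alpha>) * (\<alpha> * \<epsilon>)"
  proof (rule averaging_equation_bound[where q = p, OF G _ _ _ u])
    show "bounded (?d ` V)"
      using bounded_ppr[OF G] pq_reaches_bounded_score[OF run alpha] by (rule bounded_minus_comp)
  next
    fix u assume u: "u \<in> V"
    show "\<bar>p u\<bar> \<le> \<alpha> * \<epsilon>"
      using halted u pq_reaches_priority_nonneg[OF run alpha, of u] by fastforce
    \<comment> \<open>Regrouped so that the PageRank equation minus the invariant applies; the terms
      \<open>\<alpha> * of_bool (u = v)\<close> cancel.\<close>
    have "(\<Sum>w\<in>out_nbrs E u. ?d w + p w) =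
        (\<Sum>w\<in>out_nbrs E u. ppr \<alpha> E w v) - (\<Sum>w\<in>out_nbrs E u. s w - p w)"
      by (simp add: sum.distrib sum_subtractf)
    then show "?d u = (1 - \<alpha>) / card (out_nbrs E u) * (\<Sum>w\<in>out_nbrs E u. ?d w + p w)"
      using ppr_equation[OF G u, of v] pq_reaches_invariant[OF run out_finite u]
      by (simp add: right_diff_distrib)
  qed
  then have "\<alpha> * \<bar>?d u\<bar> \<le> \<alpha> * ((1 - \<alpha>) * \<epsilon>)" by (simp add: mult_ac)
  then have "\<bar>?d u\<bar> \<le> (1 - \<alpha>) * \<epsilon>" using alpha by simp
  \<comment> \<open>Strictness comes from the factor \<open>1 - \<alpha> < 1\<close>.\<close>
  also have "\<dots> < \<epsilon>" using alpha eps by simp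
  finally show "\<bar>s u - ppr \<alpha> E u v\<bar> < \<epsilon>" by (simp add: abs_minus_commute)
qed

end
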